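(* As $n\to\infty$, the average height of a leaf in $T_n$ (the mean of the heights over all leaves of $T_n$) is asymptotically equal to $n-\sqrt{\frac{\pi n}{2}}+O(1)$, where here $\pi$ denotes the circle constant.
   Context: $S_n$ is the set of permutations $\sigma=\sigma_1\dots\sigma_n$ of $\{1,\dots,n\}$ and $id_n=12\dots n$. The bubblesort operator $\mathbf{B}$ is one pass of the bubblesort algorithm: scan the positions from left to right, each time exchanging the current element with the one to its right whenever the latter is smaller. Equivalently, writing $\sigma=\mu_1A_1\mu_2A_2\dots\mu_kA_k$ where the $\mu_i$ are all the left-to-right maxima of $\sigma$ (elements larger than all elements to their left) and the $A_i$ are possibly empty sequences, $\mathbf{B}(\sigma)=A_1\mu_1A_2\mu_2\dots A_k\mu_k$. $T_n$ is the rooted tree whose nodes are the permutations in $S_n$, with root $id_n$, in which $\tau$ is a child of $\sigma$ if and only if $\mathbf{B}(\tau)=\sigma$ and $\sigma\ne\tau$. A leaf is a node without children. The height of a node is the number of edges on the path connecting it to the root. *)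

theory Defs
  imports "HOL-Combinatorics.Multiset_Permutations" "HOL-Library.Landau_Symbols" Complex_Main
begin

text \<open>Permutations of \<open>{1..n}\<close> are lists in one-line notation.\<close>

abbreviation perms :: "nat \<Rightarrow> nat list set" where
  "perms n \<equiv> permutations_of_set {1..n}"

definition id_perm :: "nat \<Rightarrow> nat list" where
  "id_perm n = [1..<Suc n]"

text \<open>One left-to-right pass: the larger of the first two entries is carried on to the next
  comparison.\<close>

fun bubble :: "nat list \<Rightarrow> nat list" where
  "bubble [] = []"
| "bubble [x] = [x]"
| "bubble (x # y # xs) = (if y < x then y # bubble (x # xs) else x # bubble (y # xs))"

text \<open>The edges of \<open>T\<^sub>n\<close>, directed from parent to child; the node set is \<open>perms n\<close>
  and the root is \<open>id_perm n\<close>.\<close>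

definition tree_edges :: "nat \<Rightarrow> (nat list \<times> nat list) set" where
  "tree_edges n = {(\<sigma>, \<tau>). \<sigma> \<in> perms n \<and> \<tau> \<in> perms n \<and> bubble \<tau> = \<sigma> \<and> \<sigma> \<noteq> \<tau>}"

definition leaves :: "nat \<Rightarrow> nat list set" where
  "leaves n = {\<sigma> \<in> perms n. \<not> (\<exists>\<tau>. (\<sigma>, \<tau>) \<in> tree_edges n)}"

text \<open>A node other than the root has exactly one parent and the root has none, so the path
  from the root is unique.\<close>

definition height :: "nat \<Rightarrow> nat list \<Rightarrow> nat" where
  "height n \<sigma> = (THE k. (id_perm n, \<sigma>) \<in> tree_edges n ^^ k)"

definition avg_leaf_height :: "nat \<Rightarrow> real" where
  "avg_leaf_height n = (\<Sum>\<sigma>\<in>leaves n. real (height n \<sigma>)) / real (card (leaves n))"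

end

theory Submission
  imports Defs "HOL-Probability.Distributions"
begin

text \<open>
  A bubblesort pass lowers each positive entry of the inversion table of a permutation by one, so
  the height of a node is the maximal entry of its inversion table. Inserting the smallest element
  adds one freely chosen entry to the table; hence \<open>\<Prod>i=1..n. min (k + 1) i\<close> permutations have height
  at most \<open>k\<close>. For \<open>n \<ge> 2\<close> the leaves are the permutations that do not end in \<open>n\<close>, and for
  \<open>n = N + 1\<close> the average leaf height becomes \<open>N\<close> minus the sum over \<open>m = 1..N\<close> of
  \<open>(1 - m / N) * (\<Prod>i<m. a / (a + i))\<close> with \<open>a = N - m + 1\<close>. These terms are \<open>exp (- m\<^sup>2 / (2 * N))\<close>
  up to a relative error of order \<open>m / N + m\<^sup>3 / N\<^sup>2\<close>. With \<open>s = sqrt (2 * N)\<close> and \<open>y = m / s\<close>, the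
  errors are \<open>O(1 / (s * (1 + y\<^sup>2)))\<close> and sum to \<open>O(1)\<close> by comparison with the arctangent; the main
  terms form a Riemann sum of the Gaussian integral.
\<close>

section \<open>Heights and inversion tables\<close>

text \<open>The inversion table, indexed by values rather than positions: a pass moves entries
  around, but acts on the table entry of each value separately.\<close>

fun larger_before :: "nat \<Rightarrow> nat list \<Rightarrow> nat" where
  "larger_before v [] = 0"
| "larger_before v (x # xs) =
    (if x = v then 0 else (if v < x then 1 else 0) + larger_before v xs)"

lemma set_bubble [simp]: "set (bubble xs) = set xs"
  by (induction xs rule: bubble.induct) auto

lemma length_bubble [simp]: "length (bubble xs) = length xs"
  by (induction xs rule: bubble.induct) auto

lemma distinct_bubble: "distinct xs \<Longrightarrow> distinct (bubble xs)"
  by (induction xs rule: bubble.induct) auto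

text \<open>A value that is not a left-to-right maximum is overtaken by exactly one larger entry,
  the one currently carried. A left-to-right maximum only moves past smaller entries, so its table
  entry stays 0, in agreement with truncated subtraction.\<close>

lemma larger_before_bubble:
  "distinct xs \<Longrightarrow> v \<in> set xs \<Longrightarrow> larger_before v (bubble xs) = larger_before v xs - 1"
  by (induction xs rule: bubble.induct) auto

lemma larger_before_less_length: "v \<in> set xs \<Longrightarrow> larger_before v xs < length xs"
  by (induction xs) auto

lemma sorted_iff_larger_before:
  "distinct xs \<Longrightarrow> sorted xs \<longleftrightarrow> (\<forall>v\<in>set xs. larger_before v xs = 0)"
  by (induction xs) (auto simp: not_less)

lemma bubble_sorted: "sorted xs \<Longrightarrow> bubble xs = xs"
  by (induction xs rule: bubble.induct) auto

lemma larger_before_append_notin: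
  "v \<notin> set ys \<Longrightarrow> larger_before v (ys @ zs) = length (filter ((<) v) ys) + larger_before v zs"
  by (induction ys) auto

lemma larger_before_append_in:
  "v \<in> set ys \<Longrightarrow> larger_before v (ys @ zs) = larger_before v ys"
  by (induction ys) auto

lemma larger_before_insert_smaller:
  "a < v \<Longrightarrow> larger_before v (ys @ a # zs) = larger_before v (ys @ zs)"
  by (induction ys) auto

text \<open>Inserting 0 gives the empty list a maximum and changes nothing otherwise.\<close>

definition max_larger_before :: "nat list \<Rightarrow> nat" where
  "max_larger_before xs = Max (insert 0 ((\<lambda>v. larger_before v xs) ` set xs))"

lemma max_larger_before_le_iff:
  "max_larger_before xs \<le> k \<longleftrightarrow> (\<forall>v\<in>set xs. larger_before v xs \<le> k)"
  unfolding max_larger_before_def by simp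

lemma max_larger_before_bubble:
  assumes "distinct xs"
  shows "max_larger_before (bubble xs) = max_larger_before xs - 1"
proof -
  have "max_larger_before (bubble xs) \<le> k \<longleftrightarrow> max_larger_before xs - 1 \<le> k" for k
    using assms by (auto simp: max_larger_before_le_iff larger_before_bubble le_diff_conv)
  \<comment> \<open>Naturals with the same upper bounds are equal; each instance yields one
    inequality.\<close>
  from this[of "max_larger_before (bubble xs)"] this[of "max_larger_before xs - 1"] show ?thesis
    by simp
qed

lemma max_larger_before_eq_0_iff:
  "distinct xs \<Longrightarrow> max_larger_before xs = 0 \<longleftrightarrow> sorted xs"
  using max_larger_before_le_iff[of xs 0] by (simp add: sorted_iff_larger_before)

lemma max_larger_before_le_length: "max_larger_before xs \<le> length xs - 1"
  unfolding max_larger_before_le_iff using larger_before_less_length by fastforce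

section \<open>Heights of nodes\<close>

lemma perms_iff:
  "xs \<in> permutations_of_set {m..n} \<longleftrightarrow> distinct xs \<and> set xs = {m..n}"
  by (auto simp: permutations_of_set_def)

lemma length_perm: "xs \<in> perms n \<Longrightarrow> length xs = n"
  using length_finite_permutations_of_set by fastforce

lemma id_perm_in_perms: "id_perm n \<in> perms n"
  unfolding perms_iff id_perm_def by auto

lemma sorted_perm_iff: "xs \<in> perms n \<Longrightarrow> sorted xs \<longleftrightarrow> xs = id_perm n"
  by (metis id_perm_def id_perm_in_perms perms_iff sorted_distinct_set_unique sorted_upt)

lemma bubble_in_perms: "xs \<in> perms n \<Longrightarrow> bubble xs \<in> perms n"
  by (simp add: perms_iff distinct_bubble)

text \<open>Each edge towards the root lowers the maximal table entry by one, and this entry is 0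
  only at the root. The equivalence for every \<open>k\<close> also gives the uniqueness needed for
  \<open>THE\<close> in \<open>height\<close>.\<close>

lemma tree_edges_relpow_iff:
  "\<sigma> \<in> perms n \<Longrightarrow> (id_perm n, \<sigma>) \<in> tree_edges n ^^ k \<longleftrightarrow> max_larger_before \<sigma> = k"
proof (induction k arbitrary: \<sigma>)
  case 0
  then show ?case
    using max_larger_before_eq_0_iff[of \<sigma>] sorted_perm_iff[OF 0] by (auto simp: perms_iff)
next
  case (Suc k)
  have d: "distinct \<sigma>"
    using Suc.prems by (simp add: perms_iff)
  have "bubble \<sigma> \<noteq> \<sigma> \<longleftrightarrow> max_larger_before \<sigma> \<noteq> 0"
    using max_larger_before_bubble[OF d] max_larger_before_eq_0_iff[OF d] bubble_sorted[of \<sigma>]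
    by (cases "max_larger_before \<sigma>") auto
  \<comment> \<open>The last edge of a path to \<open>\<sigma>\<close> can only start at
    \<open>bubble \<sigma>\<close>.\<close>
  moreover have "(id_perm n, \<sigma>) \<in> tree_edges n ^^ Suc k \<longleftrightarrow>
      (id_perm n, bubble \<sigma>) \<in> tree_edges n ^^ k \<and> bubble \<sigma> \<noteq> \<sigma>"
    using Suc.prems bubble_in_perms[OF Suc.prems]
    by (auto simp: tree_edges_def relcomp_unfold)
  ultimately show ?case
    using Suc.IH[OF bubble_in_perms[OF Suc.prems]] max_larger_before_bubble[OF d] by auto
qed

lemma height_eq: "\<sigma> \<in> perms n \<Longrightarrow> height n \<sigma> = max_larger_before \<sigma>"
  unfolding height_def by (simp add: tree_edges_relpow_iff)

section \<open>Characterization of leaves\<close>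

lemma bubble_Cons_max: "\<forall>x\<in>set xs. x < m \<Longrightarrow> bubble (m # xs) = xs @ [m]"
  by (induction xs) auto

lemma bubble_eq_Nil_iff [simp]: "bubble xs = [] \<longleftrightarrow> xs = []"
  by (metis length_0_conv length_bubble)

lemma last_bubble: "xs \<noteq> [] \<Longrightarrow> last (bubble xs) = Max (set xs)"
proof (induction xs rule: bubble.induct)
  case (3 x y xs)
  have "Max (set (x # y # xs)) = Max (set (max x y # xs))"
    by (cases "xs = []") (simp_all add: max.assoc)
  then show ?case
    using 3 by (auto simp: max_def not_less)
qed auto

text \<open>A pass carries the maximum to the end, so a parent ends in \<open>n\<close>; conversely,
  moving a final \<open>n\<close> to the front produces a child. For \<open>n = 1\<close> that child
  would be the root itself, which is a leaf although it ends in \<open>n\<close>.\<close>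

lemma leaves_eq:
  assumes "n \<ge> 2"
  shows "leaves n = {\<sigma> \<in> perms n. last \<sigma> \<noteq> n}"
proof -
  have "(\<exists>\<tau>. (\<sigma>, \<tau>) \<in> tree_edges n) \<longleftrightarrow> last \<sigma> = n" if "\<sigma> \<in> perms n" for \<sigma>
  proof
    assume "\<exists>\<tau>. (\<sigma>, \<tau>) \<in> tree_edges n"
    then obtain \<tau> where \<tau>: "\<tau> \<in> perms n" "bubble \<tau> = \<sigma>"
      by (auto simp: tree_edges_def)
    have "set \<tau> = {1..n}"
      using \<tau> by (simp add: perms_iff)
    moreover from this have "\<tau> \<noteq> []"
      using assms by auto
    moreover have "Max {1..n} = n"
      using assms by (intro Max_eqI) auto
    ultimately show "last \<sigma> = n"
      using last_bubble[of \<tau>] \<tau> by simp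
  next
    assume l: "last \<sigma> = n"
    have "length \<sigma> = n"
      using that by (rule length_perm)
    then obtain xs where xs: "\<sigma> = xs @ [n]"
      using l assms by (cases \<sigma> rule: rev_cases) auto
    have ne: "xs \<noteq> []"
      using xs assms \<open>length \<sigma> = n\<close> by auto
    have set_xs: "n \<notin> set xs" "distinct xs" "insert n (set xs) = {1..n}"
      using that xs by (auto simp: perms_iff)
    then have less: "x < n" if "x \<in> set xs" for x
      using that by (metis atLeastAtMost_iff insertI2 nat_less_le)
    then have "bubble (n # xs) = \<sigma>"
      using bubble_Cons_max[of xs n] xs by auto
    moreover have "n # xs \<in> perms n"
      using set_xs by (simp add: perms_iff)
    moreover have "n # xs \<noteq> \<sigma>"
      using xs ne set_xs by (cases xs) auto
    ultimately have "(\<sigma>, n # xs) \<in> tree_edges n"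
      using that by (simp add: tree_edges_def)
    then show "\<exists>\<tau>. (\<sigma>, \<tau>) \<in> tree_edges n" ..
  qed
  then show ?thesis
    unfolding leaves_def by blast
qed

section \<open>Counting by maximal table entry\<close>

text \<open>Inserting a new smallest element at position \<open>p\<close> (counted from 0) gives it
  the table entry \<open>p\<close> and leaves all other entries alone, so there are
  \<open>min (k + 1) (card S + 1)\<close> admissible positions. A general \<open>S\<close> is used
  because \<open>{1..n}\<close> without its minimum is no longer an initial segment.\<close>

lemma card_max_larger_before_le:
  assumes "finite S"
  shows "card {xs \<in> permutations_of_set S. max_larger_before xs \<le> k} = (\<Prod>i=1..card S. min (Suc k) i)"
  using assms
proof (induction S rule: finite_linorder_min_induct)
  case empty
  have "{xs \<in> permutations_of_set {}. max_larger_before xs \<le> k} = {[]}"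
    by (auto simp: max_larger_before_def)
  then show ?case
    by simp
next
  case (insert a S)
  let ?G = "\<lambda>S. {xs \<in> permutations_of_set S. max_larger_before xs \<le> k}"
  let ?ins = "\<lambda>(xs, p). take p xs @ a # drop p xs"
  let ?rem = "\<lambda>xs. (remove1 a xs, length (takeWhile ((\<noteq>) a) xs))"
  have a: "a \<notin> S" "\<forall>x\<in>S. a < x"
    using insert.hyps by auto
  have lb: "max_larger_before (ys @ a # zs) \<le> k \<longleftrightarrow>
      length ys \<le> k \<and> max_larger_before (ys @ zs) \<le> k"
    if "set (ys @ zs) = S" "distinct (ys @ zs)" for ys zs
  proof -
    have "filter ((<) a) ys = ys"
      using that a by auto
    then have "larger_before a (ys @ a # zs) = length ys"
      using that a by (subst larger_before_append_notin) auto
    moreover have "larger_before v (ys @ a # zs) = larger_before v (ys @ zs)" if "v \<in> S" for v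
      using that a by (intro larger_before_insert_smaller) auto
    moreover have "set (ys @ a # zs) = insert a S"
      using that by auto
    ultimately show ?thesis
      unfolding max_larger_before_le_iff using that(1) by auto
  qed
  have "bij_betw ?ins (?G S \<times> {..<min (Suc k) (Suc (card S))}) (?G (insert a S))"
  proof (rule bij_betw_byWitness[where f' = ?rem])
    show "\<forall>u\<in>?G S \<times> {..<min (Suc k) (Suc (card S))}. ?rem (?ins u) = u"
    proof
      fix u
      assume "u \<in> ?G S \<times> {..<min (Suc k) (Suc (card S))}"
      then obtain xs p where u: "u = (xs, p)" "xs \<in> ?G S" "p < min (Suc k) (Suc (card S))"
        by blast
      then have xs: "distinct xs" "set xs = S" and p: "p \<le> card S"
        by (simp_all add: permutations_of_set_def)
      have "a \<notin> set xs" "length xs = card S"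
        using distinct_card[OF xs(1)] xs a by auto
      moreover from this have "a \<notin> set (take p xs)"
        by (meson in_set_takeD)
      ultimately show "?rem (?ins u) = u"
        using p u by (auto simp: remove1_append takeWhile_append)
    qed
  next
    show "\<forall>xs\<in>?G (insert a S). ?ins (?rem xs) = xs"
    proof
      fix xs
      assume "xs \<in> ?G (insert a S)"
      then have "a \<in> set xs"
        by (auto simp: permutations_of_set_def)
      then obtain ys zs where "xs = ys @ a # zs" "a \<notin> set ys"
        by (meson split_list_first)
      then show "?ins (?rem xs) = xs"
        by (auto simp: remove1_append takeWhile_append)
    qed
  next
    show "?ins ` (?G S \<times> {..<min (Suc k) (Suc (card S))}) \<subseteq> ?G (insert a S)"
    proof (rule image_subsetI)
      fix u
      assume "u \<in> ?G S \<times> {..<min (Suc k) (Suc (card S))}"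
      then obtain xs p where u: "u = (xs, p)" "xs \<in> ?G S" "p < min (Suc k) (Suc (card S))"
        by blast
      then have xs: "distinct xs" "set xs = S" and p: "p \<le> k" and m: "max_larger_before xs \<le> k"
        by (simp_all add: permutations_of_set_def)
      have s: "set (take p xs @ drop p xs) = S" "distinct (take p xs @ drop p xs)"
        using xs by (simp_all only: append_take_drop_id)
      then have "set (take p xs) \<union> set (drop p xs) = S"
        by (simp only: set_append)
      moreover from this have "a \<notin> set (take p xs)" "a \<notin> set (drop p xs)"
        using a by auto
      moreover have "set (take p xs) \<inter> set (drop p xs) = {}"
        using s(2) by (simp only: distinct_append)
      moreover have "max_larger_before (take p xs @ a # drop p xs) \<le> k"
        using lb[OF s] m p by simp
      ultimately show "?ins u \<in> ?G (insert a S)"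
        using xs u by (simp add: permutations_of_set_def)
    qed
  next
    show "?rem ` ?G (insert a S) \<subseteq> ?G S \<times> {..<min (Suc k) (Suc (card S))}"
    proof (rule image_subsetI)
      fix xs
      assume "xs \<in> ?G (insert a S)"
      then have xs: "distinct xs" "set xs = insert a S" "max_larger_before xs \<le> k"
        by (auto simp: permutations_of_set_def)
      then obtain ys zs where yz: "xs = ys @ a # zs" "a \<notin> set ys"
        by (metis insertI1 split_list_first)
      have 1: "distinct (ys @ zs)" "a \<notin> set (ys @ zs)"
        using xs yz by auto
      have 2: "set (ys @ zs) = S"
        using xs yz 1 a by auto
      have "length (ys @ zs) = card S"
        using 1 2 by (metis distinct_card)
      then have "length ys \<le> card S" "length ys \<le> k" "max_larger_before (ys @ zs) \<le> k"
        using lb[OF 2 1(1)] xs yz by auto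
      moreover have "?rem xs = (ys @ zs, length ys)"
        using yz by (auto simp: remove1_append takeWhile_append)
      ultimately show "?rem xs \<in> ?G S \<times> {..<min (Suc k) (Suc (card S))}"
        using 1 2 by (simp add: permutations_of_set_def)
    qed
  qed
  then have "card (?G S \<times> {..<min (Suc k) (Suc (card S))}) = card (?G (insert a S))"
    by (rule bij_betw_same_card)
  then show ?case
    using insert a by (simp add: card_cartesian_product)
qed

text \<open>Factors with \<open>i \<le> k\<close> form the factorial; the other \<open>n - k\<close>
  factors all equal \<open>k + 1\<close>.\<close>

lemma prod_min_eq:
  assumes "k \<le> n"
  shows "(\<Prod>i=1..n. min (Suc k) i) = fact k * Suc k ^ (n - k)"
  using assms
proof (induction n rule: dec_induct)
  case base
  have "(\<Prod>i=1..k. min (Suc k) i) = \<Prod>{1..k}"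
    by (intro prod.cong) auto
  then show ?case
    by (simp add: fact_prod)
next
  case (step n)
  then show ?case
    using step by (simp add: Suc_diff_le min_absorb1 ring_distribs del: One_nat_def)
qed

lemma card_perms_max_larger_before_le:
  "card {\<sigma> \<in> perms n. max_larger_before \<sigma> \<le> k} = (\<Prod>i=1..n. min (Suc k) i)"
  using card_max_larger_before_le[of "{1..n}" k] by simp

text \<open>A maximum appended at the end has table entry 0 and does not affect the others, so the
  count reduces to \<open>perms n\<close>.\<close>

lemma card_perms_last_eq:
  "card {\<sigma> \<in> perms (Suc n). last \<sigma> = Suc n \<and> max_larger_before \<sigma> \<le> k} = (\<Prod>i=1..n. min (Suc k) i)"
proof -
  have ext: "max_larger_before (xs @ [Suc n]) \<le> k \<longleftrightarrow> max_larger_before xs \<le> k"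
    if "xs \<in> perms n" for xs
  proof -
    have "filter ((<) (Suc n)) xs = []" "Suc n \<notin> set xs"
      using that by (auto simp: perms_iff filter_empty_conv)
    then show ?thesis
      by (simp add: max_larger_before_le_iff larger_before_append_in larger_before_append_notin)
  qed
  have "{\<sigma> \<in> perms (Suc n). last \<sigma> = Suc n \<and> max_larger_before \<sigma> \<le> k} =
      (\<lambda>xs. xs @ [Suc n]) ` {\<sigma> \<in> perms n. max_larger_before \<sigma> \<le> k}" (is "?L = ?R")
  proof
    show "?L \<subseteq> ?R"
    proof
      fix \<sigma>
      assume \<sigma>: "\<sigma> \<in> ?L"
      then have "length \<sigma> = Suc n"
        using length_perm by blast
      with \<sigma> obtain xs where xs: "\<sigma> = xs @ [Suc n]"
        by (cases \<sigma> rule: rev_cases) auto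
      have "distinct xs" "Suc n \<notin> set xs" "insert (Suc n) (set xs) = {1..Suc n}"
        using \<sigma> xs by (auto simp: perms_iff)
      then have "xs \<in> perms n"
        using atLeastAtMostSuc_conv[of 1 n] insert_ident[of "Suc n" "set xs" "{1..n}"]
        by (simp add: perms_iff)
      then show "\<sigma> \<in> ?R"
        using \<sigma> xs ext by auto
    qed
    show "?R \<subseteq> ?L"
      using ext by (auto simp: perms_iff)
  qed
  then show ?thesis
    using card_perms_max_larger_before_le by (simp add: card_image inj_on_def)
qed

text \<open>Subtracting the permutations that end in \<open>n + 1\<close> turns the last factor
  \<open>min (k + 1) (n + 1) = k + 1\<close> of the product into \<open>k\<close>.\<close>

lemma card_leaves_height_le:
  assumes "n \<ge> 1" "k \<le> n"
  shows "card {\<sigma> \<in> leaves (Suc n). height (Suc n) \<sigma> \<le> k} = k * fact k * Suc k ^ (n - k)"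
proof -
  let ?A = "{\<sigma> \<in> perms (Suc n). max_larger_before \<sigma> \<le> k}"
  let ?B = "{\<sigma> \<in> perms (Suc n). last \<sigma> = Suc n \<and> max_larger_before \<sigma> \<le> k}"
  have "{\<sigma> \<in> leaves (Suc n). height (Suc n) \<sigma> \<le> k} = ?A - ?B"
    using assms by (auto simp: leaves_eq height_eq)
  moreover have "card (?A - ?B) = card ?A - card ?B"
    by (intro card_Diff_subset) (auto intro: finite_subset[OF _ finite_permutations_of_set])
  ultimately show ?thesis
    using assms
    by (simp add: card_perms_max_larger_before_le card_perms_last_eq prod_min_eq
        del: One_nat_def flip: Suc_eq_plus1)
qed

section \<open>Exact formula for the average\<close>

text \<open>The tail-sum formula, which makes the total height computable from the cumulative
  counts.\<close>

lemma sum_eq_sum_card_greater: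
  assumes "finite A" "\<And>x. x \<in> A \<Longrightarrow> f x \<le> (N :: nat)"
  shows "sum f A = (\<Sum>k<N. card {x \<in> A. k < f x})"
proof -
  have "f x = (\<Sum>k<N. if k < f x then 1 else 0)" if "x \<in> A" for x
  proof -
    have "{..<N} \<inter> {k. k < f x} = {..<f x}"
      using assms(2)[OF that] by auto
    then show ?thesis
      by (simp add: sum.If_cases)
  qed
  then have "sum f A = (\<Sum>x\<in>A. \<Sum>k<N. if k < f x then 1 else 0)"
    by (rule sum.cong[OF refl])
  also have "\<dots> = (\<Sum>k<N. \<Sum>x\<in>A. if k < f x then 1 else 0)"
    by (rule sum.swap)
  also have "\<dots> = (\<Sum>k<N. card {x \<in> A. k < f x})"
    using assms(1) by (simp add: sum.If_cases Int_def)
  finally show ?thesis .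
qed

lemma avg_leaf_height_eq:
  assumes "n \<ge> 1"
  shows "avg_leaf_height (Suc n) =
    real n - (\<Sum>k<n. real k * fact k * real (Suc k) ^ (n - k) / (real n * fact n))"
proof -
  let ?L = "leaves (Suc n)" and ?h = "height (Suc n)"
  have fin: "finite ?L"
    by (auto simp: leaves_def)
  have h: "?h \<sigma> \<le> n" if "\<sigma> \<in> ?L" for \<sigma>
    using that max_larger_before_le_length[of \<sigma>] length_perm[of \<sigma> "Suc n"]
    by (simp add: height_eq leaves_def)
  then have "{\<sigma> \<in> ?L. ?h \<sigma> \<le> n} = ?L"
    by blast
  \<comment> \<open>No height exceeds \<open>n\<close>, so the cumulative count at
    \<open>k = n\<close> counts all leaves.\<close>
  then have cL: "card ?L = n * fact n"
    using card_leaves_height_le[OF assms order_refl] by simp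
  have "real (card {\<sigma> \<in> ?L. k < ?h \<sigma>}) =
      real n * fact n - real k * fact k * real (Suc k) ^ (n - k)" if "k < n" for k
  proof -
    have "{\<sigma> \<in> ?L. k < ?h \<sigma>} = ?L - {\<sigma> \<in> ?L. ?h \<sigma> \<le> k}"
      by auto
    then have "real (card {\<sigma> \<in> ?L. k < ?h \<sigma>}) = real (card ?L) - real (card {\<sigma> \<in> ?L. ?h \<sigma> \<le> k})"
      using fin by (simp add: card_Diff_subset card_mono of_nat_diff)
    then show ?thesis
      using that card_leaves_height_le[OF assms, of k] cL by simp
  qed
  then have "real (sum ?h ?L) = (\<Sum>k<n. real n * fact n - real k * fact k * real (Suc k) ^ (n - k))"
    by (subst sum_eq_sum_card_greater[OF fin h]) simp_all
  then show ?thesis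
    using assms unfolding avg_leaf_height_def cL
    by (simp add: sum_subtractf sum_divide_distrib diff_divide_distrib)
qed

section \<open>Gaussian Riemann sums\<close>

text \<open>The integral test with mesh \<open>1 / s\<close>, phrased with a primitive
  \<open>F\<close>: the mean value theorem places each increment of \<open>F\<close> between the
  values of \<open>g\<close> at the two endpoints.\<close>

lemma sum_antimono_deriv_bounds:
  fixes F g :: "real \<Rightarrow> real"
  assumes deriv: "\<And>x. x \<ge> 0 \<Longrightarrow> (F has_real_derivative g x) (at x)"
    and anti: "\<And>x y. 0 \<le> x \<Longrightarrow> x \<le> y \<Longrightarrow> g y \<le> g x"
    and "s > 0"
  shows "(\<Sum>m=1..N. g (real m / s)) \<le> s * (F (real N / s) - F 0)"
    and "s * (F (real N / s) - F 0) \<le> (\<Sum>m<N. g (real m / s))"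
proof -
  have step: "g (real (Suc m) / s) \<le> s * (F (real (Suc m) / s) - F (real m / s))"
    "s * (F (real (Suc m) / s) - F (real m / s)) \<le> g (real m / s)" for m
  proof -
    let ?a = "real m / s" and ?b = "real (Suc m) / s"
    have ab: "0 \<le> ?a" "?a < ?b" "?b - ?a = 1 / s"
      using \<open>s > 0\<close> by (simp_all add: divide_strict_right_mono diff_divide_distrib[symmetric])
    have "\<exists>z. ?a < z \<and> z < ?b \<and> F ?b - F ?a = (?b - ?a) * g z"
      using ab deriv by (intro MVT2) auto
    then obtain z where z: "?a < z" "z < ?b" "F ?b - F ?a = (?b - ?a) * g z"
      by blast
    then have "s * (F ?b - F ?a) = g z"
      using ab(3) \<open>s > 0\<close> by simp
    then show "g ?b \<le> s * (F ?b - F ?a)" "s * (F ?b - F ?a) \<le> g ?a"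
      using anti[of z ?b] anti[of ?a z] z ab by auto
  qed
  show "(\<Sum>m=1..N. g (real m / s)) \<le> s * (F (real N / s) - F 0)"
  proof (induction N)
    case (Suc N)
    then show ?case
      using step(1)[of N] by (simp add: algebra_simps)
  qed simp
  show "s * (F (real N / s) - F 0) \<le> (\<Sum>m<N. g (real m / s))"
  proof (induction N)
    case (Suc N)
    then show ?case
      using step(2)[of N] by (simp add: algebra_simps)
  qed simp
qed

lemma gauss_primitive_exists:
  obtains F :: "real \<Rightarrow> real" where "F 0 = 0"
    and "\<And>x. x \<ge> 0 \<Longrightarrow> (F has_real_derivative exp (- x\<^sup>2)) (at x)"
    and "(F \<longlongrightarrow> sqrt pi / 2) at_top"
proof -
  let ?g = "\<lambda>t::real. exp (- t\<^sup>2)"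
  \<comment> \<open>Starting the integral at -1 makes 0 an interior point, so that the derivative
    there is two-sided.\<close>
  define F where "F = (\<lambda>x::real. integral {-1..x} ?g - integral {-1..0} ?g)"
  have "F 0 = 0"
    by (simp add: F_def)
  moreover have "(F has_real_derivative exp (- x\<^sup>2)) (at x)" if "x \<ge> 0" for x
  proof -
    have "((\<lambda>x. integral {-1..x} ?g) has_real_derivative ?g x) (at x within {-1..x + 1})"
      using that by (intro integral_has_real_derivative continuous_intros) auto
    moreover have "at x within {-1..x + 1} = at x"
      using that by (intro at_within_interior) auto
    ultimately show ?thesis
      unfolding F_def by (auto intro!: derivative_eq_intros)
  qed
  moreover have "(F \<longlongrightarrow> sqrt pi / 2) at_top"
  proof -
    have "((\<lambda>y. \<integral>x. indicator {..y} x *\<^sub>R (indicator {0..} x *\<^sub>R ?g x) \<partial>lborel)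
        \<longlongrightarrow> (\<integral>x. indicator {0..} x *\<^sub>R ?g x \<partial>lborel)) at_top"
      by (intro tendsto_integral_at_top integrable.intros[OF gaussian_moment_0]) simp
    moreover have "(\<integral>x. indicator {0..} x *\<^sub>R ?g x \<partial>lborel) = sqrt pi / 2"
      using gaussian_moment_0 by (rule has_bochner_integral_integral_eq)
    moreover have "(\<integral>x. indicator {..y} x *\<^sub>R (indicator {0..} x *\<^sub>R ?g x) \<partial>lborel) = F y"
      if "y \<ge> 0" for y
    proof -
      have "set_integrable lborel {0..y} ?g"
        by (intro borel_integrable_atLeastAtMost' continuous_intros)
      from set_borel_integral_eq_integral(2)[OF this]
      have "(\<integral>x. indicator {0..y} x *\<^sub>R ?g x \<partial>lborel) = integral {0..y} ?g"
        unfolding set_lebesgue_integral_def .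
      moreover have "(\<integral>x. indicator {..y} x *\<^sub>R (indicator {0..} x *\<^sub>R ?g x) \<partial>lborel) =
          (\<integral>x. indicator {0..y} x *\<^sub>R ?g x \<partial>lborel)"
        by (intro Bochner_Integration.integral_cong) (simp_all split: split_indicator)
      moreover have "integral {-1..0} ?g + integral {0..y} ?g = integral {-1..y} ?g"
        using that
        by (intro Henstock_Kurzweil_Integration.integral_combine integrable_continuous_real
            continuous_intros) auto
      ultimately show ?thesis
        unfolding F_def by linarith
  qed
    ultimately show "(F \<longlongrightarrow> sqrt pi / 2) at_top"
      by (smt (verit) eventually_at_top_linorder filterlim_cong)
  qed
  ultimately show thesis
    by (rule that)
qed

text \<open>Integral comparison with total mass \<open>sqrt pi / 2\<close>. In the lower bound,
  \<open>s\<^sup>2 / N\<close> is \<open>s\<close> times the tail bound \<open>1 / x\<close> at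
  \<open>x = N / s\<close>, and 1 is the term \<open>m = 0\<close>.\<close>

lemma sum_exp_neg_square_bounds:
  assumes "s > 0"
  shows "(\<Sum>m=1..N. exp (- (real m / s)\<^sup>2)) \<le> s * sqrt pi / 2"
    and "N > 0 \<Longrightarrow> s * sqrt pi / 2 - s\<^sup>2 / real N - 1 \<le> (\<Sum>m=1..N. exp (- (real m / s)\<^sup>2))"
proof -
  obtain F :: "real \<Rightarrow> real" where F0: "F 0 = 0"
    and F': "\<And>x. x \<ge> 0 \<Longrightarrow> (F has_real_derivative exp (- x\<^sup>2)) (at x)"
    and lim: "(F \<longlongrightarrow> sqrt pi / 2) at_top"
    using gauss_primitive_exists by blast
  have anti: "exp (- y\<^sup>2) \<le> exp (- x\<^sup>2)" if "0 \<le> x" "x \<le> y" for x y :: real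
    using that by (simp add: power_mono)
  note bounds = sum_antimono_deriv_bounds[of F "\<lambda>x. exp (- x\<^sup>2)", OF F' anti assms]
  have "F x \<le> sqrt pi / 2" if "x \<ge> 0" for x
  proof (rule tendsto_lowerbound[OF lim])
    show "\<forall>\<^sub>F y in at_top. F x \<le> F y"
      using eventually_ge_at_top[of x]
    proof eventually_elim
      case (elim y)
      then show ?case
        using that by (intro DERIV_nonneg_imp_nondecreasing[of x y F]) (auto intro!: F' exI)
    qed
  qed simp
  then have "s * (F (real N / s) - F 0) \<le> s * (sqrt pi / 2)"
    using assms F0 by simp
  then show "(\<Sum>m=1..N. exp (- (real m / s)\<^sup>2)) \<le> s * sqrt pi / 2"
    using bounds(1)[of N] by simp
  \<comment> \<open>\<open>F y + 1 / y\<close> is nonincreasing because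
    \<open>exp (- z\<^sup>2) \<le> 1 / z\<^sup>2\<close>, and it has the same limit as
    \<open>F\<close>.\<close>
  have tail: "sqrt pi / 2 \<le> F x + 1 / x" if "x > 0" for x
  proof (rule tendsto_upperbound)
    show "((\<lambda>y. F y + 1 / y) \<longlongrightarrow> sqrt pi / 2) at_top"
      using tendsto_add[OF lim tendsto_divide_0[OF tendsto_const filterlim_at_top_imp_at_infinity[OF filterlim_ident]]]
      by simp
    show "\<forall>\<^sub>F y in at_top. F y + 1 / y \<le> F x + 1 / x"
      using eventually_ge_at_top[of x]
    proof eventually_elim
      case (elim y)
      show ?case
      proof (rule DERIV_nonpos_imp_nonincreasing[OF elim])
        fix z
        assume "x \<le> z" "z \<le> y"
        then have z: "z > 0"
          using that by simp
        have "((\<lambda>y. F y + 1 / y) has_real_derivative exp (- z\<^sup>2) - 1 / z\<^sup>2) (at z)"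
          using z by (auto intro!: derivative_eq_intros F' simp: power2_eq_square)
        moreover have "exp (- z\<^sup>2) \<le> 1 / z\<^sup>2"
        proof -
          have "z\<^sup>2 \<le> exp (z\<^sup>2)"
            using exp_ge_add_one_self[of "z\<^sup>2"] by linarith
          then show ?thesis
            using z by (simp add: exp_minus field_simps)
        qed
        ultimately show "\<exists>D. ((\<lambda>y. F y + 1 / y) has_real_derivative D) (at z) \<and> D \<le> 0"
          by (intro exI conjI) auto
      qed
    qed
  qed simp
  assume "N > 0"
  then have "s * (sqrt pi / 2) \<le> s * (F (real N / s) + 1 / (real N / s))"
    using assms by (intro mult_left_mono tail) auto
  then have "s * sqrt pi / 2 - s\<^sup>2 / real N \<le> s * (F (real N / s) - F 0)"
    using F0 by (simp add: power2_eq_square algebra_simps)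
  also have "\<dots> \<le> (\<Sum>m<N. exp (- (real m / s)\<^sup>2))"
    by (rule bounds(2))
  also have "\<dots> \<le> (\<Sum>m<Suc N. exp (- (real m / s)\<^sup>2))"
    by simp
  also have "\<dots> = 1 + (\<Sum>m=1..N. exp (- (real m / s)\<^sup>2))"
    by (simp only: sum.lessThan_Suc_shift sum.atLeast1_atMost_eq One_nat_def) simp
  finally show "s * sqrt pi / 2 - s\<^sup>2 / real N - 1 \<le> (\<Sum>m=1..N. exp (- (real m / s)\<^sup>2))"
    by simp
qed

lemma sum_inverse_one_plus_square_le:
  assumes "s > 0"
  shows "(\<Sum>m=1..N. 1 / (1 + (real m / s)\<^sup>2)) \<le> s * (pi / 2)"
proof -
  have "(\<Sum>m=1..N. 1 / (1 + (real m / s)\<^sup>2)) \<le> s * (arctan (real N / s) - arctan 0)"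
  proof (rule sum_antimono_deriv_bounds(1)[OF _ _ assms])
    show "(arctan has_real_derivative 1 / (1 + x\<^sup>2)) (at x)" for x
      by (auto intro!: derivative_eq_intros simp: field_simps)
    show "1 / (1 + y\<^sup>2) \<le> 1 / (1 + x\<^sup>2)" if "0 \<le> x" "x \<le> y" for x y :: real
      using that by (intro divide_left_mono) (auto simp: power_mono add_pos_nonneg)
  qed
  also have "\<dots> \<le> s * (pi / 2)"
    using assms arctan_ubound[of "real N / s"] by (intro mult_left_mono) auto
  finally show ?thesis .
qed

section \<open>Asymptotics of the average leaf height\<close>

text \<open>Splits off the top \<open>m\<close> factors, so that
  \<open>fact (n - m) * a ^ m / fact n\<close> becomes a product of ratios
  \<open>a / (a + i)\<close>.\<close>

lemma fact_eq_prod: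
  assumes "m \<le> n"
  shows "fact n = fact (n - m) * (\<Prod>i<m. real (n - m + 1) + real i)"
  using assms
proof (induction m)
  case (Suc m)
  have n: "n - m = Suc (n - Suc m)"
    using Suc.prems by simp
  have "fact n = fact (n - m) * (\<Prod>i<m. real (n - m + 1) + real i)"
    using Suc by simp
  also have "\<dots> = fact (n - Suc m) * (real (n - m) * (\<Prod>i<m. real (n - m) + real (Suc i)))"
    by (simp add: n algebra_simps)
  also have "real (n - m) * (\<Prod>i<m. real (n - m) + real (Suc i)) = (\<Prod>i<Suc m. real (n - m) + real i)"
    by (simp only: prod.lessThan_Suc_shift) simp
  finally show ?case
    by (simp add: n)
qed simp

lemma sum_lessThan_real: "(\<Sum>i<m. real i) = real m * (real m - 1) / 2"
  by (induction m) (simp_all add: field_simps)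

text \<open>Each factor is \<open>1 - i / (a + i) \<le> exp (- i / b)\<close>, since
  \<open>a + i \<le> b\<close>. In the application \<open>b = N\<close> equals
  \<open>a + m - 1\<close>.\<close>

lemma prod_ratio_upper:
  assumes "a > 0" "a + real m - 1 \<le> b"
  shows "(\<Prod>i<m. a / (a + real i)) \<le> exp (- (real m * (real m - 1) / (2 * b)))"
proof -
  have "(\<Prod>i<m. a / (a + real i)) \<le> (\<Prod>i<m. exp (- real i / b))"
  proof (intro prod_mono conjI)
    fix i
    assume "i \<in> {..<m}"
    then have "real i + 1 \<le> real m"
      by simp
    then have "a + real i \<le> b" "0 < a + real i"
      using assms by linarith+
    then have "- (real i / (a + real i)) \<le> - real i / b"
      by (simp add: frac_le)
    moreover have "a / (a + real i) = 1 + - (real i / (a + real i))"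
      using assms(1) by (simp add: field_simps)
    ultimately show "a / (a + real i) \<le> exp (- real i / b)"
      using exp_ge_add_one_self[of "- (real i / (a + real i))"]
      by (metis exp_le_cancel_iff order.trans)
  qed (use assms(1) in auto)
  also have "\<dots> = exp (- ((\<Sum>i<m. real i) / b))"
    by (simp add: exp_sum[symmetric] sum_divide_distrib sum_negf)
  also have "(\<Sum>i<m. real i) / b = real m * (real m - 1) / (2 * b)"
    by (simp add: sum_lessThan_real)
  finally show ?thesis .
qed

text \<open>Each factor is \<open>1 / (1 + i / a)\<close>, and
  \<open>1 + i / a \<le> exp (i / a)\<close>.\<close>

lemma prod_ratio_lower:
  assumes "a > 0"
  shows "exp (- (real m * (real m - 1) / (2 * a))) \<le> (\<Prod>i<m. a / (a + real i))"
proof -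
  have "real m * (real m - 1) / (2 * a) = (\<Sum>i<m. real i) / a"
    by (simp add: sum_lessThan_real)
  also have "exp (- \<dots>) = (\<Prod>i<m. exp (- real i / a))"
    by (simp add: exp_sum[symmetric] sum_divide_distrib sum_negf)
  also have "\<dots> \<le> (\<Prod>i<m. a / (a + real i))"
  proof (intro prod_mono conjI)
    fix i
    have "1 + real i / a \<le> exp (real i / a)"
      by simp
    then have "inverse (exp (real i / a)) \<le> inverse (1 + real i / a)"
      using assms by (intro le_imp_inverse_le) (auto simp: add_pos_nonneg)
    then show "exp (- real i / a) \<le> a / (a + real i)"
      using assms by (simp add: exp_minus field_simps)
  qed auto
  finally show ?thesis .
qed

text \<open>In the lower bound, the weight exceeds 1 as soon as \<open>2 * m > N\<close>, so that it covers the range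
  where the Gaussian approximation fails.\<close>

lemma leaf_ratio_bounds:
  fixes m N :: nat
  assumes "1 \<le> m" "m \<le> N"
  defines "u \<equiv> real (N - m) * fact (N - m) * real (Suc (N - m)) ^ m / (real N * fact N)"
    and "E \<equiv> exp (- (real m)\<^sup>2 / (2 * real N))"
  shows "u \<le> E"
    and "E - E * (real m / real N + 8 * real m ^ 3 / (real N)\<^sup>2) \<le> u"
proof -
  define a where "a = real (N - m + 1)"
  define r where "r = (\<Prod>i<m. a / (a + real i))"
  have a: "a = real N - real m + 1" "a > 0"
    using assms(2) by (simp_all add: a_def of_nat_diff)
  have N: "real N > 0" "real m \<le> real N" "real m \<ge> 1"
    using assms by simp_all
  have "(\<Prod>i<m. a + real i) > 0"
    using a by (intro prod_pos) auto
  then have "fact (N - m) * a ^ m / fact N = r"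
    by (simp add: fact_eq_prod[OF assms(2), folded a_def] r_def prod_dividef)
  moreover have "u = real (N - m) / real N * (fact (N - m) * a ^ m / fact N)"
    by (simp add: u_def a_def)
  ultimately have u: "u = (1 - real m / real N) * r"
    using assms(2) N by (simp add: of_nat_diff diff_divide_distrib)
  have E_pos: "E > 0"
    by (simp add: E_def)
  have r_pos: "0 \<le> r"
    using a by (auto simp: r_def intro!: prod_nonneg)
  have q: "0 \<le> 1 - real m / real N"
    using N by simp
  \<comment> \<open>Since \<open>1 - m / N \<le> exp (- m / N)\<close>, the exponents add up to
    \<open>- (m\<^sup>2 + m) / (2 * N)\<close>.\<close>
  have "u \<le> exp (- (real m / real N)) * exp (- (real m * (real m - 1) / (2 * real N)))"
    unfolding u r_def using exp_ge_add_one_self[of "- (real m / real N)"] q r_pos a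
    by (intro mult_mono prod_ratio_upper) (auto simp: r_def)
  also have "\<dots> = exp (- ((real m)\<^sup>2 + real m) / (2 * real N))"
    using N by (simp add: exp_add[symmetric] field_simps power2_eq_square)
  also have "\<dots> \<le> E"
    unfolding E_def exp_le_cancel_iff using N by (intro divide_right_mono) auto
  finally show "u \<le> E" .
  define e d where "e = real m / real N" and "d = real m ^ 3 / (real N)\<^sup>2"
  have ed: "0 \<le> e" "0 \<le> d"
    by (simp_all add: e_def d_def)
  have "E - E * (e + 8 * d) \<le> u"
  proof (cases "2 * m \<le> N")
    case True
    then have half: "2 * real m \<le> real N"
      using of_nat_mono[OF True, where 'a = real] by simp
    have "real m * (real m - 1) / (2 * a) \<le> (real m)\<^sup>2 / (2 * (real N - real m))"
      using a N half by (intro frac_le) (auto simp: power2_eq_square)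
    \<comment> \<open>Uses \<open>1 / (N - m) = 1 / N + m / (N * (N - m))\<close>; the excess is at
      most \<open>d\<close> because \<open>2 * (N - m) \<ge> N\<close>.\<close>
    also have "\<dots> = (real m)\<^sup>2 / (2 * real N) + real m ^ 3 / (real N * (2 * (real N - real m)))"
      using N half by (simp add: field_simps power2_eq_square power3_eq_cube)
    also have "real m ^ 3 / (real N * (2 * (real N - real m))) \<le> d"
      unfolding d_def power2_eq_square using N half by (intro divide_left_mono mult_left_mono) auto
    finally have "exp (- ((real m)\<^sup>2 / (2 * real N) + d)) \<le> r"
      unfolding r_def by (intro order.trans[OF _ prod_ratio_lower[OF a(2)]]) simp
    then have "E * exp (- d) \<le> r"
      by (simp add: E_def exp_add[symmetric])
    moreover have "E * (1 - d) \<le> E * exp (- d)"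
      using exp_ge_add_one_self[of "- d"] E_pos by (intro mult_left_mono) auto
    ultimately have "(1 - e) * (E * (1 - d)) \<le> u"
      unfolding u e_def[symmetric] using q[folded e_def] by (intro mult_left_mono) auto
    moreover have "0 \<le> E * (e * d + 7 * d)"
      using E_pos ed by simp
    ultimately show ?thesis
      by (simp add: algebra_simps)
  next
    case False
    then have "real N \<le> 2 * real m"
      by linarith
    \<comment> \<open>The factor \<open>8 = 2 ^ 3\<close> comes from here:
      \<open>8 * m ^ 3 \<ge> N ^ 3 \<ge> N\<^sup>2\<close>, so the claimed lower bound is at most
      0.\<close>
    then have "real N ^ 3 \<le> (2 * real m) ^ 3"
      by (intro power_mono) auto
    moreover have "real N ^ 2 \<le> real N ^ 3"
      using N by (intro power_increasing) auto
    ultimately have "1 \<le> 8 * d"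
      using N by (simp add: d_def power_mult_distrib)
    then have "E * 1 \<le> E * (e + 8 * d)"
      using E_pos by (intro mult_left_mono add_increasing ed) auto
    moreover have "0 \<le> u"
      unfolding u using q r_pos by simp
    ultimately show ?thesis
      by simp
  qed
  then show "E - E * (real m / real N + 8 * real m ^ 3 / (real N)\<^sup>2) \<le> u"
    by (simp add: e_def d_def)
qed

text \<open>Trades the Gaussian times a cubic for a multiple of the derivative of the arctangent,
  whose sums are under control.\<close>

lemma exp_neg_square_weight_le:
  fixes y :: real
  assumes "y \<ge> 0"
  shows "exp (- y\<^sup>2) * (2 * y + 32 * y ^ 3) \<le> 432 / (1 + y\<^sup>2)"
proof -
  let ?z = "y\<^sup>2"
  have z: "0 < 1 + ?z"
    by (simp add: add_pos_nonneg)
  have "0 \<le> (y - 1)\<^sup>2"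
    by simp
  then have "2 * y \<le> 1 + ?z"
    by (simp add: power2_eq_square algebra_simps)
  then have "2 * y * (16 * (1 + ?z)) \<le> (1 + ?z) * (16 * (1 + ?z))"
    using z by (intro mult_right_mono) auto
  then have "2 * y + 32 * y ^ 3 \<le> 16 * (1 + ?z)\<^sup>2"
    using assms z by (simp add: power2_eq_square power3_eq_cube algebra_simps)
  then have "(2 * y + 32 * y ^ 3) * (1 + ?z) \<le> 16 * (1 + ?z)\<^sup>2 * (1 + ?z)"
    using z by (intro mult_right_mono) auto
  \<comment> \<open>Here \<open>432 = 16 * 27\<close>; dividing by 3 inside the cube permits
    \<open>(1 + ?z) / 3 \<le> exp (?z / 3)\<close>, and the cube of the right-hand side is
    \<open>exp ?z\<close>.\<close>
  also have "\<dots> = 432 * ((1 + ?z) / 3) ^ 3"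
    by (simp add: power2_eq_square power3_eq_cube)
  also have "\<dots> \<le> 432 * exp (?z / 3) ^ 3"
  proof (intro mult_left_mono power_mono)
    show "(1 + ?z) / 3 \<le> exp (?z / 3)"
      using exp_ge_add_one_self[of "?z / 3"] unfolding add_divide_distrib by linarith
  qed (use z in auto)
  also have "exp (?z / 3) ^ 3 = exp ?z"
    by (simp flip: exp_of_nat_mult)
  finally show ?thesis
    using z by (simp add: exp_minus field_simps)
qed

section \<open>Summing the term bounds\<close>

lemma avg_leaf_height_bounds:
  assumes "N \<ge> 1"
  shows "real N - sqrt (pi * real N / 2) \<le> avg_leaf_height (Suc N)"
    and "avg_leaf_height (Suc N) \<le> real N - sqrt (pi * real N / 2) + (3 + 216 * pi)"
proof -
  define s where "s = sqrt (2 * real N)"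
  define u where "u = (\<lambda>m. real (N - m) * fact (N - m) * real (Suc (N - m)) ^ m / (real N * fact N))"
  define E where "E = (\<lambda>m. exp (- (real m / s)\<^sup>2))"
  have s: "s > 0" "s\<^sup>2 = 2 * real N"
    using assms by (simp_all add: s_def)
  have E_eq: "E m = exp (- (real m)\<^sup>2 / (2 * real N))" for m
    by (simp add: E_def power_divide s)
  have avg: "avg_leaf_height (Suc N) = real N - (\<Sum>m=1..N. u m)"
  proof -
    \<comment> \<open>Substituting \<open>m = N - k\<close> makes the dominant terms those with
      small \<open>m\<close>.\<close>
    have "(\<Sum>k<N. real k * fact k * real (Suc k) ^ (N - k) / (real N * fact N)) = (\<Sum>m=1..N. u m)"
      by (rule sum.reindex_bij_witness[where i = "\<lambda>m. N - m" and j = "\<lambda>k. N - k"])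
        (auto simp: u_def)
    then show ?thesis
      using avg_leaf_height_eq[OF assms] by simp
  qed
  have main: "s * sqrt pi / 2 = sqrt (pi * real N / 2)"
  proof -
    have "s * sqrt pi / 2 = sqrt ((s * sqrt pi / 2)\<^sup>2)"
      using s by simp
    also have "(s * sqrt pi / 2)\<^sup>2 = pi * real N / 2"
      by (simp add: power_mult_distrib power_divide s)
    finally show ?thesis .
  qed
  have "(\<Sum>m=1..N. u m) \<le> (\<Sum>m=1..N. E m)"
    unfolding E_eq u_def by (intro sum_mono leaf_ratio_bounds) auto
  also have "\<dots> \<le> sqrt (pi * real N / 2)"
    using sum_exp_neg_square_bounds(1)[OF s(1), of N] by (simp add: E_def main)
  finally show "real N - sqrt (pi * real N / 2) \<le> avg_leaf_height (Suc N)"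
    by (simp add: avg)
  have "E m - u m \<le> 432 / s * (1 / (1 + (real m / s)\<^sup>2))" if "m \<in> {1..N}" for m
  proof -
    let ?y = "real m / s"
    have "E m - u m \<le> E m * (real m / real N + 8 * real m ^ 3 / (real N)\<^sup>2)"
      using leaf_ratio_bounds(2)[of m N] that by (simp add: u_def E_eq)
    \<comment> \<open>With \<open>N = s\<^sup>2 / 2\<close> and \<open>m = s * ?y\<close>, both
      error terms acquire a common factor \<open>1 / s\<close>, which cancels the \<open>s\<close>
      from the arctangent sum.\<close>
    also have "real m / real N + 8 * real m ^ 3 / (real N)\<^sup>2 = (2 * ?y + 32 * ?y ^ 3) / s"
    proof -
      have N: "real N = s\<^sup>2 / 2"
        using s by simp
      show ?thesis
        unfolding N using s(1) by (simp add: field_simps eval_nat_numeral)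
    qed
    also have "E m * ((2 * ?y + 32 * ?y ^ 3) / s) = exp (- ?y\<^sup>2) * (2 * ?y + 32 * ?y ^ 3) / s"
      by (simp add: E_def)
    also have "\<dots> \<le> 432 / (1 + ?y\<^sup>2) / s"
      using s by (intro divide_right_mono exp_neg_square_weight_le) auto
    finally show ?thesis
      by (simp add: mult.commute)
  qed
  then have "(\<Sum>m=1..N. E m - u m) \<le> (\<Sum>m=1..N. 432 / s * (1 / (1 + (real m / s)\<^sup>2)))"
    by (rule sum_mono)
  also have "\<dots> = 432 / s * (\<Sum>m=1..N. 1 / (1 + (real m / s)\<^sup>2))"
    by (rule sum_distrib_left[symmetric])
  also have "\<dots> \<le> 432 / s * (s * (pi / 2))"
    using s by (intro mult_left_mono sum_inverse_one_plus_square_le) auto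
  also have "\<dots> = 216 * pi"
    using s by simp
  finally have "(\<Sum>m=1..N. E m) - (\<Sum>m=1..N. u m) \<le> 216 * pi"
    by (simp add: sum_subtractf)
  \<comment> \<open>The loss 3 is \<open>s\<^sup>2 / N + 1\<close> with
    \<open>s\<^sup>2 = 2 * N\<close>.\<close>
  moreover have "sqrt (pi * real N / 2) - 3 \<le> (\<Sum>m=1..N. E m)"
    using sum_exp_neg_square_bounds(2)[OF s(1), of N] assms s by (simp add: E_def main)
  ultimately show "avg_leaf_height (Suc N) \<le> real N - sqrt (pi * real N / 2) + (3 + 216 * pi)"
    by (simp add: avg)
qed

theorem proposition4p9:
  "(\<lambda>n. avg_leaf_height n - (real n - sqrt (pi * real n / 2))) \<in> O(\<lambda>_. 1)"
proof (rule bigoI[where c = "5 + 216 * pi"])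
  show "\<forall>\<^sub>F n in at_top. norm (avg_leaf_height n - (real n - sqrt (pi * real n / 2)))
      \<le> (5 + 216 * pi) * norm (1 :: real)"
    using eventually_ge_at_top[of 2]
  proof eventually_elim
    case (elim n)
    then obtain N where n: "n = Suc N" "N \<ge> 1"
      by (cases n) auto
    \<comment> \<open>Passing from \<open>N\<close> to \<open>n = N + 1\<close> shifts the linear
      term by 1 and, by subadditivity, the square root by at most
      \<open>sqrt (pi / 2) \<le> 2\<close>; the constant 5 absorbs this together with the 3.\<close>
    have "pi * real n / 2 = pi * real N / 2 + pi / 2"
      by (simp add: n field_simps)
    then have "sqrt (pi * real n / 2) \<le> sqrt (pi * real N / 2) + sqrt (pi / 2)"
      by (metis sqrt_add_le_add_sqrt divide_nonneg_nonneg mult_nonneg_nonneg of_nat_0_le_iff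
          pi_ge_zero zero_le_numeral)
    moreover have "sqrt (pi / 2) \<le> 2"
      using pi_less_4 by (intro real_le_lsqrt) auto
    moreover have "sqrt (pi * real N / 2) \<le> sqrt (pi * real n / 2)"
      using n by simp
    moreover have "real n = real N + 1"
      by (simp add: n)
    ultimately have "\<bar>avg_leaf_height n - (real n - sqrt (pi * real n / 2))\<bar> \<le> 5 + 216 * pi"
      using avg_leaf_height_bounds[OF n(2), folded n(1)] pi_gt_zero by linarith
    then show ?case
      by simp
  qed
qed

end
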